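(* Let $M$ be a finitely generated $\mathbb{Z}^2$-graded $S$-module with minimal free resolution \[ F_\bullet:\quad \bigoplus_{i,j\geq 0}S(-i,-j)^{\beta_{0,(i,j)}}\leftarrow \bigoplus_{i,j\geq 0}S(-i,-j)^{\beta_{1,(i,j)}} \leftarrow \cdots\leftarrow \bigoplus_{i,j\geq 0}S(-i,-j)^{\beta_{k,(i,j)}} \leftarrow \cdots . \] Then the Hilbert matrix $H_M$ satisfies, for all $(i,j)\in\mathbb{Z}^2$, \[ \big((\Delta^C)^{n+1}(\Delta^R)^{m+1}H_M\big)_{i,j}=B_{i,j}, \] where $B_{p,q}=\sum_{k=0}^{\infty}(-1)^k\beta_{k,(p,q)}$ for all $(p,q)\in\mathbb{Z}^2$.
   Context: $\Bbbk$ is an algebraically closed field and $S=\Bbbk[x_0,\dots,x_n,y_0,\dots,y_m]$ is the Cox ring of $\mathbb{P}^n\times\mathbb{P}^m$, with $\mathbb{Z}^2$-grading $\deg(x_i)=(1,0)$, $\deg(y_j)=(0,1)$. The Hilbert matrix of $M$ is the matrix indexed by $\mathbb{Z}^2$ with entries $H_M(i,j)=\dim_{\Bbbk}M_{(i,j)}$. For any infinite matrix $H=(H_{i,j})$ indexed by $\mathbb{Z}^2$, the column and row difference operators are $\Delta^C(H)_{i,j}=H_{i,j}-H_{i-1,j}$ and $\Delta^R(H)_{i,j}=H_{i,j}-H_{i,j-1}$ (these commute). *)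

theory Defs
  imports
    Complex_Main
    "HOL-Library.Cardinality"
    "HOL-Library.Poly_Mapping"
    "HOL-Library.Product_Plus"
    "HOL-Computational_Algebra.Polynomial"
begin

section \<open>The Cox ring of a product of two projective spaces\<close>

text \<open>
  The variables are indexed by a disjoint sum of two finite types: \<open>Inl i\<close> stands for \<open>x\<^sub>i\<close> and
  \<open>Inr j\<close> for \<open>y\<^sub>j\<close>. For \<open>CARD('n) = n + 1\<close> and \<open>CARD('m) = m + 1\<close> this is the ring
  \<open>k[x\<^sub>0, \<dots>, x\<^sub>n, y\<^sub>0, \<dots>, y\<^sub>m]\<close>.
\<close>

type_synonym ('n, 'm, 'k) cox = "(('n + 'm) \<Rightarrow>\<^sub>0 nat) \<Rightarrow>\<^sub>0 'k"

definition cox_const :: "'k::field \<Rightarrow> ('n, 'm, 'k) cox" where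
  "cox_const c = Poly_Mapping.single 0 c"

definition cox_var :: "'n + 'm \<Rightarrow> ('n, 'm, 'k::field) cox" where
  "cox_var v = Poly_Mapping.single (Poly_Mapping.single v 1) 1"

definition mon_bideg :: "(('n::finite + 'm::finite) \<Rightarrow>\<^sub>0 nat) \<Rightarrow> int \<times> int" where
  "mon_bideg t =
     ((\<Sum>i\<in>UNIV. int (Poly_Mapping.lookup t (Inl i))),
      (\<Sum>j\<in>UNIV. int (Poly_Mapping.lookup t (Inr j))))"

definition cox_gr :: "int \<times> int \<Rightarrow> ('n::finite, 'm::finite, 'k::field) cox set" where
  "cox_gr d = {p. \<forall>t\<in>Poly_Mapping.keys p. mon_bideg t = d}"

definition cox_max_ideal :: "('n::finite, 'm::finite, 'k::field) cox set" where
  "cox_max_ideal = module.span (*) (cox_var ` UNIV)"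


section \<open>Bigraded modules and Hilbert matrices\<close>

locale bigraded_module = module scale
  for scale :: "('n::finite, 'm::finite, 'k::field) cox \<Rightarrow> 'b::ab_group_add \<Rightarrow> 'b" +
  fixes gr :: "int \<times> int \<Rightarrow> 'b set"
  assumes gr_zero: "0 \<in> gr d"
    and gr_add: "x \<in> gr d \<Longrightarrow> y \<in> gr d \<Longrightarrow> x + y \<in> gr d"
    and gr_uminus: "x \<in> gr d \<Longrightarrow> - x \<in> gr d"
    and gr_scale: "p \<in> cox_gr d \<Longrightarrow> x \<in> gr e \<Longrightarrow> scale p x \<in> gr (d + e)"
    and gr_direct_sum:
      "\<exists>!f. (\<forall>d. f d \<in> gr d) \<and> finite {d. f d \<noteq> 0} \<and> x = (\<Sum>d | f d \<noteq> 0. f d)"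

definition fin_gen_module ::
  "(('n::finite, 'm::finite, 'k::field) cox \<Rightarrow> 'b::ab_group_add \<Rightarrow> 'b) \<Rightarrow> bool" where
  "fin_gen_module scale \<longleftrightarrow> (\<exists>G. finite G \<and> module.span scale G = UNIV)"

definition hilbert_matrix ::
  "(('n::finite, 'm::finite, 'k::field) cox \<Rightarrow> 'b::ab_group_add \<Rightarrow> 'b) \<Rightarrow>
   (int \<times> int \<Rightarrow> 'b set) \<Rightarrow> int \<Rightarrow> int \<Rightarrow> int" where
  "hilbert_matrix scale gr i j =
     int (vector_space.dim (\<lambda>c. scale (cox_const c)) (gr (i, j)))"

definition diff_col :: "(int \<Rightarrow> int \<Rightarrow> 'a::ab_group_add) \<Rightarrow> int \<Rightarrow> int \<Rightarrow> 'a" where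
  "diff_col H = (\<lambda>i j. H i j - H (i - 1) j)"

definition diff_row :: "(int \<Rightarrow> int \<Rightarrow> 'a::ab_group_add) \<Rightarrow> int \<Rightarrow> int \<Rightarrow> 'a" where
  "diff_row H = (\<lambda>i j. H i j - H i (j - 1))"


section \<open>Bigraded free modules\<close>

text \<open>
  For \<open>b :: int \<times> int \<Rightarrow> nat\<close>, the module \<open>\<Oplus>\<^sub>e S(-e)\<^bsup>b e\<^esup>\<close> consists of the finitely supported families of
  ring elements indexed by pairs \<open>(e, l)\<close> with \<open>l < b e\<close>. The basis vector at \<open>(e, l)\<close> has
  bidegree \<open>e\<close>. All these modules live in one ambient type, on which the ring acts
  coordinatewise.
\<close>

type_synonym ('n, 'm, 'k) cox_free = "((int \<times> int) \<times> nat) \<Rightarrow>\<^sub>0 ('n, 'm, 'k) cox"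

definition free_scale ::
  "('n, 'm, 'k::field) cox \<Rightarrow> ('n, 'm, 'k) cox_free \<Rightarrow> ('n, 'm, 'k) cox_free" where
  "free_scale p f = Poly_Mapping.map ((*) p) f"

definition free_mod :: "(int \<times> int \<Rightarrow> nat) \<Rightarrow> ('n, 'm, 'k::field) cox_free set" where
  "free_mod b = {f. \<forall>(e, l)\<in>Poly_Mapping.keys f. l < b e}"

definition twist :: "(int \<times> int \<Rightarrow> 'c set) \<Rightarrow> int \<times> int \<Rightarrow> int \<times> int \<Rightarrow> 'c set" where
  "twist gr a = (\<lambda>d. gr (a + d))"

definition free_gr ::
  "(int \<times> int \<Rightarrow> nat) \<Rightarrow> int \<times> int \<Rightarrow> ('n::finite, 'm::finite, 'k::field) cox_free set" where
  "free_gr b d =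
     {f \<in> free_mod b. \<forall>e l. Poly_Mapping.lookup f (e, l) \<in> twist cox_gr (- e) d}"

lemma lookup_free_scale:
  "Poly_Mapping.lookup (free_scale p f) e = p * Poly_Mapping.lookup f e"
  by (simp add: free_scale_def Poly_Mapping.map.rep_eq when_def)

lemma module_free_scale: "module free_scale"
  by unfold_locales
    (auto intro!: poly_mapping_eqI simp: lookup_free_scale lookup_add algebra_simps)


section \<open>Minimal free resolutions\<close>

text \<open>
  \<open>A\<close> and \<open>gA\<close> are the carrier and the homogeneous components of the source, \<open>gB\<close> the
  homogeneous components of the target; maps only matter on their source carrier.
\<close>

definition graded_hom_on ::
  "('r \<Rightarrow> 'a::plus \<Rightarrow> 'a) \<Rightarrow> 'a set \<Rightarrow> (int \<times> int \<Rightarrow> 'a set) \<Rightarrow>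
   ('r \<Rightarrow> 'c::plus \<Rightarrow> 'c) \<Rightarrow> (int \<times> int \<Rightarrow> 'c set) \<Rightarrow> ('a \<Rightarrow> 'c) \<Rightarrow> bool" where
  "graded_hom_on sA A gA sB gB f \<longleftrightarrow>
     (\<forall>x\<in>A. \<forall>y\<in>A. f (x + y) = f x + f y) \<and>
     (\<forall>p. \<forall>x\<in>A. f (sA p x) = sB p (f x)) \<and>
     (\<forall>d. f ` gA d \<subseteq> gB d)"

definition ideal_times_free ::
  "('n::finite, 'm::finite, 'k::field) cox set \<Rightarrow> ('n, 'm, 'k) cox_free set \<Rightarrow>
   ('n, 'm, 'k) cox_free set" where
  "ideal_times_free I N = module.span free_scale {free_scale p f | p f. p \<in> I \<and> f \<in> N}"

text \<open>
  The resolution is \<open>0 \<leftarrow> M \<leftarrow> F\<^sub>0 \<leftarrow> F\<^sub>1 \<leftarrow> \<dots>\<close> with \<open>F\<^sub>k = \<Oplus>\<^sub>e S(-e)\<^bsup>\<beta> k e\<^esup>\<close>, augmentation \<open>\<epsilon> : F\<^sub>0 \<rightarrow> M\<close> and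
  differentials \<open>\<delta> k : F\<^sub>k\<^sub>+\<^sub>1 \<rightarrow> F\<^sub>k\<close>. All twists are by pairs of nonnegative integers. Minimality
  refers to the ideal generated by all the variables, not to the irrelevant ideal of the
  product of projective spaces.
\<close>

definition minimal_free_resolution ::
  "(('n::finite, 'm::finite, 'k::field) cox \<Rightarrow> 'b::ab_group_add \<Rightarrow> 'b) \<Rightarrow>
   (int \<times> int \<Rightarrow> 'b set) \<Rightarrow> (nat \<Rightarrow> int \<times> int \<Rightarrow> nat) \<Rightarrow>
   (('n, 'm, 'k) cox_free \<Rightarrow> 'b) \<Rightarrow>
   (nat \<Rightarrow> ('n, 'm, 'k) cox_free \<Rightarrow> ('n, 'm, 'k) cox_free) \<Rightarrow> bool" where
  "minimal_free_resolution scale gr \<beta> \<epsilon> \<delta> \<longleftrightarrow>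
     (\<forall>k i j. \<beta> k (i, j) \<noteq> 0 \<longrightarrow> i \<ge> 0 \<and> j \<ge> 0) \<and>
     graded_hom_on free_scale (free_mod (\<beta> 0)) (free_gr (\<beta> 0)) scale gr \<epsilon> \<and>
     (\<forall>k. graded_hom_on free_scale (free_mod (\<beta> (Suc k))) (free_gr (\<beta> (Suc k)))
            free_scale (free_gr (\<beta> k)) (\<delta> k)) \<and>
     \<epsilon> ` free_mod (\<beta> 0) = UNIV \<and>
     \<delta> 0 ` free_mod (\<beta> 1) = {f \<in> free_mod (\<beta> 0). \<epsilon> f = 0} \<and>
     (\<forall>k. \<delta> (Suc k) ` free_mod (\<beta> (Suc (Suc k))) =
            {f \<in> free_mod (\<beta> (Suc k)). \<delta> k f = 0}) \<and>
     (\<forall>k. \<delta> k ` free_mod (\<beta> (Suc k)) \<subseteq>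
            ideal_times_free cox_max_ideal (free_mod (\<beta> k)))"

definition betti_alt_sum :: "(nat \<Rightarrow> int \<times> int \<Rightarrow> nat) \<Rightarrow> int \<Rightarrow> int \<Rightarrow> int" where
  "betti_alt_sum \<beta> p q = suminf (\<lambda>k. (- 1) ^ k * int (\<beta> k (p, q)))"

end

theory Submission
  imports Defs
begin

text \<open>
  Minimality forces \<open>\<beta> k e = 0\<close> as soon as \<open>k\<close> exceeds the total degree of \<open>e\<close>: a basis vector of
  \<open>F\<^sub>k\<^sub>+\<^sub>1\<close> of total degree at most \<open>k\<close> is mapped to an element of \<open>\<mm>F\<^sub>k\<close> of degree at most \<open>k\<close>,
  which is \<open>0\<close> as \<open>F\<^sub>k\<close> lives in degrees at least \<open>k\<close>; by exactness the basis vector then lies in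
  \<open>\<mm>F\<^sub>k\<^sub>+\<^sub>1\<close>, which is absurd. Hence in each bidegree the resolution is a finite exact sequence of
  finite-dimensional vector spaces, and \<open>H\<^sub>M\<close> is the alternating sum of the Hilbert functions of the
  \<open>F\<^sub>k\<close>. The Hilbert function of \<open>S\<close> counts monomials, and one difference removes one
  variable, so all of them together leave the indicator function of \<open>(0, 0)\<close>.
\<close>

section \<open>Constant coefficients, restriction of scalars to the field, bidegrees of
  monomials\<close>

lemma lookup_cox_const_times:
  "Poly_Mapping.lookup (cox_const c * p) t = c * Poly_Mapping.lookup p t"
  by (simp add: cox_const_def mult_map_scale_conv_mult[symmetric] Poly_Mapping.map.rep_eq when_def)

text \<open>A sum of exponent vectors vanishes only if both summands do, so a single product
  contributes to the constant coefficient. This coefficient later detects elements outside the ideal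
  of the variables.\<close>

lemma lookup_times_0:
  fixes p q :: "('v \<Rightarrow>\<^sub>0 nat) \<Rightarrow>\<^sub>0 'k::comm_ring_1"
  shows "Poly_Mapping.lookup (p * q) 0 = Poly_Mapping.lookup p 0 * Poly_Mapping.lookup q 0"
proof -
  have eq: "0 = s + t \<longleftrightarrow> s = 0 \<and> t = 0" for s t :: "'v \<Rightarrow>\<^sub>0 nat"
    by (auto simp: poly_mapping_eq_iff lookup_add fun_eq_iff)
  have "(if s = 0 \<and> t = 0 then x else 0) = (if t = 0 then if s = 0 then x else 0 else 0)"
    for s t :: "'v \<Rightarrow>\<^sub>0 nat" and x :: 'k by auto
  then show ?thesis
    unfolding lookup_mult eq
    by (simp add: when_def if_distrib[of "\<lambda>x. _ * x"] cong: if_cong)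
qed

lemma vector_space_cox_const:
  assumes "module s"
  shows "vector_space (\<lambda>c::'k::field. s (cox_const c :: ('n, 'm, 'k) cox))"
proof -
  interpret module s by fact
  have "cox_const (a + b) = (cox_const a + cox_const b :: ('n, 'm, 'k) cox)" for a b
    by (simp add: cox_const_def single_add)
  moreover have "cox_const (a * b) = (cox_const a * cox_const b :: ('n, 'm, 'k) cox)" for a b
    by (simp add: cox_const_def mult_single)
  moreover have "cox_const 1 = (1 :: ('n, 'm, 'k) cox)"
    by (simp add: cox_const_def)
  ultimately show ?thesis
    by unfold_locales (simp_all add: scale_right_distrib scale_left_distrib)
qed

interpretation free_vs: vector_space
  "\<lambda>c::'k::field. free_scale (cox_const c :: ('n, 'm, 'k) cox)"
  by (rule vector_space_cox_const[OF module_free_scale])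

lemma lookup_free_scale_const:
  "Poly_Mapping.lookup (Poly_Mapping.lookup (free_scale (cox_const c) f) x) t =
     c * Poly_Mapping.lookup (Poly_Mapping.lookup f x) t"
  by (simp add: lookup_free_scale lookup_cox_const_times)

lemma mon_bideg_add: "mon_bideg (s + t) = mon_bideg s + mon_bideg t"
  by (simp add: mon_bideg_def lookup_add sum.distrib)

lemma mon_bideg_0 [simp]: "mon_bideg 0 = 0"
  by (simp add: mon_bideg_def zero_prod_def)

lemma mon_bideg_Inl: "mon_bideg (Poly_Mapping.single (Inl x) 1) = (1, 0)"
  by (simp add: mon_bideg_def lookup_single when_def flip: of_nat_sum)

lemma mon_bideg_Inr: "mon_bideg (Poly_Mapping.single (Inr x) 1) = (0, 1)"
  by (simp add: mon_bideg_def lookup_single when_def flip: of_nat_sum)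

lemma mon_bideg_nonneg: "fst (mon_bideg t) \<ge> 0" "snd (mon_bideg t) \<ge> 0"
  by (simp_all add: mon_bideg_def sum_nonneg)

lemma mon_bideg_bound:
  "int (Poly_Mapping.lookup t v) \<le> fst (mon_bideg t) + snd (mon_bideg t)"
proof -
  have *: "int (Poly_Mapping.lookup t (f x)) \<le> (\<Sum>y\<in>UNIV. int (Poly_Mapping.lookup t (f y)))"
    for f :: "'x::finite \<Rightarrow> 'a + 'b" and x
    by (rule member_le_sum) auto
  show ?thesis
    using *[of Inl] *[of Inr] mon_bideg_nonneg[of t]
    by (cases v) (fastforce simp: mon_bideg_def intro: add_increasing add_increasing2 sum_nonneg)+
qed

lemma mon_bideg_eq_0:
  assumes "fst (mon_bideg t) + snd (mon_bideg t) \<le> 0"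
  shows "t = 0"
  using mon_bideg_bound[of t] assms
  by (intro poly_mapping_eqI) (metis lookup_zero of_nat_le_0_iff order_trans)

section \<open>Counting monomials\<close>

text \<open>The set \<open>A\<close> of admissible variables is a parameter so that variables can be
  removed one at a time.\<close>

definition mons :: "('n::finite + 'm::finite) set \<Rightarrow> int \<times> int \<Rightarrow> (('n + 'm) \<Rightarrow>\<^sub>0 nat) set" where
  "mons A d = {t. Poly_Mapping.keys t \<subseteq> A \<and> mon_bideg t = d}"

lemma finite_mons: "finite (mons A d)"
proof -
  define B where "B = {..nat (fst d + snd d)}"
  have "finite {f :: 'a + 'b \<Rightarrow> nat. \<forall>v. (v \<in> UNIV \<longrightarrow> f v \<in> B) \<and> (v \<notin> UNIV \<longrightarrow> f v = 0)}"
    by (rule finite_set_of_finite_funs) (auto simp: B_def)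
  moreover have "Poly_Mapping.lookup ` mons A d \<subseteq> {f. \<forall>v. (v \<in> UNIV \<longrightarrow> f v \<in> B) \<and> (v \<notin> UNIV \<longrightarrow> f v = 0)}"
  proof -
    have "Poly_Mapping.lookup t v \<in> B" if "t \<in> mons A d" for t v
      using mon_bideg_bound[of t v] that by (auto simp: mons_def B_def)
    then show ?thesis by auto
  qed
  ultimately have "finite (Poly_Mapping.lookup ` mons A d)"
    by (rule rev_finite_subset)
  then show ?thesis
    by (rule finite_imageD) (auto simp: inj_on_def)
qed

text \<open>A monomial in the larger set of variables either avoids \<open>v\<close> or is
  \<open>v\<close> times a unique monomial of degree lower by the degree of \<open>v\<close>.
  Counting both kinds is the exact sequence for multiplication by \<open>v\<close>.\<close>

lemma card_mons_insert:
  assumes "v \<notin> A"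
  shows "int (card (mons (insert v A) d)) -
           int (card (mons (insert v A) (d - mon_bideg (Poly_Mapping.single v 1)))) =
         int (card (mons A d))"
proof -
  let ?x = "Poly_Mapping.single v 1 :: _ \<Rightarrow>\<^sub>0 nat"
  let ?S = "(\<lambda>t. t + ?x) ` mons (insert v A) (d - mon_bideg ?x)"
  have "mons (insert v A) d = mons A d \<union> ?S"
  proof (intro equalityI subsetI)
    fix t assume t: "t \<in> mons (insert v A) d"
    show "t \<in> mons A d \<union> ?S"
    proof (cases "Poly_Mapping.lookup t v = 0")
      case True
      then show ?thesis using t by (auto simp: mons_def in_keys_iff)
    next
      case False
      \<comment> \<open>Subtraction of exponents is truncated, so this needs the exponent of
        \<open>v\<close> to be positive.\<close>
      then have eq: "t = (t - ?x) + ?x"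
        by (intro poly_mapping_eqI) (auto simp: lookup_add lookup_minus lookup_single when_def)
      have "Poly_Mapping.keys (t - ?x) \<subseteq> insert v A"
      proof -
        have "Poly_Mapping.keys (t - ?x) \<subseteq> Poly_Mapping.keys t"
          by (auto simp: in_keys_iff lookup_minus)
        then show ?thesis using t by (auto simp: mons_def)
      qed
      moreover have "mon_bideg (t - ?x) = d - mon_bideg ?x"
        using t arg_cong[OF eq, of mon_bideg] by (simp add: mon_bideg_add mons_def algebra_simps)
      ultimately show ?thesis using eq by (auto simp: mons_def)
    qed
  next
    fix t assume "t \<in> mons A d \<union> ?S"
    then show "t \<in> mons (insert v A) d"
      using keys_add[of _ ?x] by (fastforce simp: mons_def mon_bideg_add)
  qed
  moreover have "mons A d \<inter> ?S = {}"
  proof -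
    have "v \<in> Poly_Mapping.keys (t + ?x)" for t
      by (simp add: in_keys_iff lookup_add)
    then show ?thesis
      using assms by (fastforce simp: mons_def)
  qed
  moreover have "card ?S = card (mons (insert v A) (d - mon_bideg ?x))"
    by (intro card_image) (auto simp: inj_on_def)
  ultimately show ?thesis
    by (simp add: card_Un_disjoint finite_mons)
qed

text \<open>This is the Hilbert function of the polynomial ring in the variables \<open>A\<close>,
  with integer values so that differences can be taken.\<close>

definition mon_count :: "('n::finite + 'm::finite) set \<Rightarrow> int \<Rightarrow> int \<Rightarrow> int" where
  "mon_count A i j = int (card (mons A (i, j)))"

lemma diff_col_mon_count:
  assumes "Inl x \<notin> A"
  shows "diff_col (mon_count (insert (Inl x) A)) = mon_count A"
  using card_mons_insert[OF assms]
  by (auto simp: fun_eq_iff diff_col_def mon_count_def mon_bideg_Inl[unfolded One_nat_def])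

lemma diff_row_mon_count:
  assumes "Inr x \<notin> A"
  shows "diff_row (mon_count (insert (Inr x) A)) = mon_count A"
  using card_mons_insert[OF assms]
  by (auto simp: fun_eq_iff diff_row_def mon_count_def mon_bideg_Inr[unfolded One_nat_def])

lemma diff_col_pow_mon_count:
  assumes "finite X" "Inl ` X \<inter> A = {}"
  shows "(diff_col ^^ card X) (mon_count (Inl ` X \<union> A)) = mon_count A"
  using assms
  \<comment> \<open>With \<open>funpow_Suc_right\<close> the first difference removes the inserted
    variable, and the remaining ones fall under the induction hypothesis.\<close>
  by (induction X) (auto simp: funpow_Suc_right diff_col_mon_count image_iff simp del: funpow.simps)

text \<open>The remainder \<open>A\<close> is general because the row differences are applied first,
  while all the \<open>Inl\<close> variables are still present.\<close>

lemma diff_row_pow_mon_count: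
  assumes "finite X" "Inr ` X \<inter> A = {}"
  shows "(diff_row ^^ card X) (mon_count (Inr ` X \<union> A)) = mon_count A"
  using assms
  by (induction X) (auto simp: funpow_Suc_right diff_row_mon_count image_iff simp del: funpow.simps)

lemma mon_count_empty: "mon_count {} i j = (if i = 0 \<and> j = 0 then 1 else 0)"
proof -
  have "mons {} (i, j) = (if i = 0 \<and> j = 0 then {0 :: 'a + 'b \<Rightarrow>\<^sub>0 nat} else {})"
    by (auto simp: mons_def mon_bideg_def)
  then show ?thesis by (simp add: mon_count_def)
qed

lemma diff_mon_count_UNIV:
  "(diff_col ^^ CARD('n)) ((diff_row ^^ CARD('m)) (mon_count (UNIV :: ('n::finite + 'm::finite) set))) i j
     = (if i = 0 \<and> j = 0 then 1 else 0)"
proof -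
  have disj: "range Inr \<inter> range Inl = ({} :: ('n + 'm) set)" by auto
  have "(diff_row ^^ CARD('m)) (mon_count (UNIV :: ('n + 'm) set)) = mon_count (range Inl :: ('n + 'm) set)"
    using diff_row_pow_mon_count[of "UNIV :: 'm set" "range Inl :: ('n + 'm) set"]
    by (simp add: UNIV_sum Un_commute[of "range Inl"] disj)
  then show ?thesis
    using diff_col_pow_mon_count[of UNIV "{} :: ('n + 'm) set"]
    by (simp add: mon_count_empty)
qed

section \<open>Difference operators\<close>

text \<open>Iterated differences only look at entries with smaller or equal indices. Hence a formula
  for the Hilbert matrix on the quadrant below \<open>(I, J)\<close> suffices, and it may depend on
  \<open>(I, J)\<close>.\<close>

lemma diff_col_pow_local:
  assumes "\<And>i j. i \<le> I \<Longrightarrow> j \<le> J \<Longrightarrow> F i j = G i j" "i \<le> I" "j \<le> J"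
  shows "(diff_col ^^ r) F i j = (diff_col ^^ r) G i j"
  using assms(2,3) by (induction r arbitrary: i j) (auto simp: assms(1) diff_col_def)

lemma diff_row_pow_local:
  assumes "\<And>i j. i \<le> I \<Longrightarrow> j \<le> J \<Longrightarrow> F i j = G i j" "i \<le> I" "j \<le> J"
  shows "(diff_row ^^ r) F i j = (diff_row ^^ r) G i j"
  using assms(2,3) by (induction r arbitrary: i j) (auto simp: assms(1) diff_row_def)

text \<open>Differences are linear and commute with translations, so they pass through a convolution
  onto one factor.\<close>

lemma diff_col_pow_sum:
  fixes G :: "int \<Rightarrow> int \<Rightarrow> 'a::comm_ring"
  shows "(diff_col ^^ r) (\<lambda>i j. \<Sum>e\<in>E. c e * G (i - fst e) (j - snd e)) =
    (\<lambda>i j. \<Sum>e\<in>E. c e * (diff_col ^^ r) G (i - fst e) (j - snd e))"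
  by (induction r)
    (auto simp: diff_col_def fun_eq_iff right_diff_distrib sum_subtractf algebra_simps)

lemma diff_row_pow_sum:
  fixes G :: "int \<Rightarrow> int \<Rightarrow> 'a::comm_ring"
  shows "(diff_row ^^ r) (\<lambda>i j. \<Sum>e\<in>E. c e * G (i - fst e) (j - snd e)) =
    (\<lambda>i j. \<Sum>e\<in>E. c e * (diff_row ^^ r) G (i - fst e) (j - snd e))"
  by (induction r)
    (auto simp: diff_row_def fun_eq_iff right_diff_distrib sum_subtractf algebra_simps)

section \<open>Bases of graded pieces\<close>

definition free_basis_vec :: "(int \<times> int) \<times> nat \<times> (('n + 'm) \<Rightarrow>\<^sub>0 nat) \<Rightarrow> ('n, 'm, 'k::field) cox_free" where
  "free_basis_vec = (\<lambda>(e, l, t). Poly_Mapping.single (e, l) (Poly_Mapping.single t 1))"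

definition free_basis_ind ::
  "(int \<times> int \<Rightarrow> nat) \<Rightarrow> int \<times> int \<Rightarrow> ((int \<times> int) \<times> nat \<times> (('n::finite + 'm::finite) \<Rightarrow>\<^sub>0 nat)) set" where
  "free_basis_ind b d = {(e, l, t). l < b e \<and> e + mon_bideg t = d}"

lemma lookup_free_basis_vec:
  "Poly_Mapping.lookup (Poly_Mapping.lookup (free_basis_vec \<tau>) (e, l)) t = (if \<tau> = (e, l, t) then 1 else 0)"
  by (auto simp: free_basis_vec_def lookup_single when_def split: prod.splits)

lemma free_mod_iff:
  "f \<in> free_mod b \<longleftrightarrow>
     (\<forall>e l t. Poly_Mapping.lookup (Poly_Mapping.lookup f (e, l)) t \<noteq> 0 \<longrightarrow> l < b e)"
proof -
  have "p \<noteq> 0 \<longleftrightarrow> (\<exists>t. Poly_Mapping.lookup p t \<noteq> 0)" for p :: "('a, 'b, 'c) cox"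
    by (metis lookup_zero poly_mapping_eqI)
  then show ?thesis
    unfolding free_mod_def in_keys_iff mem_Collect_eq Ball_def split_paired_All prod.case by blast
qed

text \<open>Everything is read off from scalar coefficients indexed by triples
  \<open>(e, l, t)\<close>, which stand for the monomial \<open>t\<close> times the basis vector at
  \<open>(e, l)\<close>.\<close>

lemma free_gr_iff:
  fixes f :: "('n::finite, 'm::finite, 'k::field) cox_free"
  shows "f \<in> free_gr b d \<longleftrightarrow>
     (\<forall>e l t. Poly_Mapping.lookup (Poly_Mapping.lookup f (e, l)) t \<noteq> 0 \<longrightarrow> (e, l, t) \<in> free_basis_ind b d)"
proof -
  have "mon_bideg t = - e + d \<longleftrightarrow> e + mon_bideg t = d" for t :: "('n + 'm) \<Rightarrow>\<^sub>0 nat" and e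
    by (auto simp: algebra_simps)
  then show ?thesis
    unfolding free_gr_def free_mod_iff twist_def cox_gr_def in_keys_iff free_basis_ind_def Ball_def
    by blast
qed

lemma inj_free_basis_vec:
  "inj (free_basis_vec :: (int \<times> int) \<times> nat \<times> (('n + 'm) \<Rightarrow>\<^sub>0 nat) \<Rightarrow> ('n, 'm, 'k::field) cox_free)"
proof (rule injI)
  fix \<sigma> \<tau> :: "(int \<times> int) \<times> nat \<times> (('n + 'm) \<Rightarrow>\<^sub>0 nat)"
  assume eq: "free_basis_vec \<sigma> = (free_basis_vec \<tau> :: ('n, 'm, 'k) cox_free)"
  obtain e l t where \<tau>: "\<tau> = (e, l, t)" by (cases \<tau>)
  show "\<sigma> = \<tau>"
    using arg_cong[OF eq, of "\<lambda>f. Poly_Mapping.lookup (Poly_Mapping.lookup f (e, l)) t"]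
    by (simp add: lookup_free_basis_vec \<tau> split: if_splits)
qed

lemma subspace_free_gr: "free_vs.subspace (free_gr b d)"
  by (rule free_vs.subspaceI)
    (auto simp: free_gr_iff lookup_add lookup_free_scale_const, metis add.right_neutral)

lemma dim_free_gr:
  assumes "finite (free_basis_ind b d :: (_ \<times> _ \<times> (('n::finite + 'm::finite) \<Rightarrow>\<^sub>0 nat)) set)"
  shows "free_vs.dim (free_gr b d :: ('n, 'm, 'k::field) cox_free set) =
      card (free_basis_ind b d :: (_ \<times> _ \<times> (('n + 'm) \<Rightarrow>\<^sub>0 nat)) set)"
    and "\<exists>B. finite B \<and> (free_gr b d :: ('n, 'm, 'k) cox_free set) \<subseteq> free_vs.span B"
proof -
  let ?T = "free_basis_ind b d :: (_ \<times> _ \<times> (('n + 'm) \<Rightarrow>\<^sub>0 nat)) set"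
  let ?B = "free_basis_vec ` ?T :: ('n, 'm, 'k) cox_free set"
  \<comment> \<open>The coefficients of a combination are its scalars. This gives both spanning and
    independence.\<close>
  have lk: "Poly_Mapping.lookup (Poly_Mapping.lookup
        (\<Sum>\<tau>\<in>T. free_scale (cox_const (c \<tau>)) (free_basis_vec \<tau> :: ('n, 'm, 'k) cox_free)) (e, l)) t
      = (if (e, l, t) \<in> T then c (e, l, t) else 0)" if "finite T" for T c e l t
    using that
    by (simp add: lookup_sum lookup_free_scale_const lookup_free_basis_vec if_distrib[of "\<lambda>x. _ * x"] sum.delta'
        cong: if_cong)
  have span: "free_gr b d \<subseteq> free_vs.span ?B"
  proof
    fix f :: "('n, 'm, 'k) cox_free" assume f: "f \<in> free_gr b d"
    let ?c = "\<lambda>(e, l, t). Poly_Mapping.lookup (Poly_Mapping.lookup f (e, l)) t"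
    have "f = (\<Sum>\<tau>\<in>?T. free_scale (cox_const (?c \<tau>))
           (free_basis_vec \<tau>))"
    proof (intro poly_mapping_eqI)
      fix x :: "(int \<times> int) \<times> nat" and t
      obtain e l where "x = (e, l)" by (cases x)
      then show "Poly_Mapping.lookup (Poly_Mapping.lookup f x) t = Poly_Mapping.lookup (Poly_Mapping.lookup
          (\<Sum>\<tau>\<in>?T. free_scale (cox_const (?c \<tau>)) (free_basis_vec \<tau>)) x) t"
        using f unfolding free_gr_iff by (auto simp only: lk[OF assms] prod.case split: if_splits)
    qed
    also have "\<dots> \<in> free_vs.span ?B"
      by (intro free_vs.span_sum free_vs.span_scale free_vs.span_base) auto
    finally show "f \<in> free_vs.span ?B" .
  qed
  have "free_vs.independent ?B"
  proof (rule free_vs.independent_if_scalars_zero)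
    show "finite ?B" using assms by simp
    fix c x assume s: "(\<Sum>x\<in>?B. free_scale (cox_const (c x)) x) = 0" and "x \<in> ?B"
    then obtain e l t where x: "x = free_basis_vec (e, l, t)" "(e, l, t) \<in> ?T" by auto
    have "(\<Sum>\<tau>\<in>?T. free_scale (cox_const (c (free_basis_vec \<tau>))) (free_basis_vec \<tau>)) = 0"
      using s by (subst (asm) sum.reindex) (auto intro: inj_on_subset[OF inj_free_basis_vec])
    then show "c x = 0" using lk[OF assms, of "\<lambda>\<tau>. c (free_basis_vec \<tau>)" e l t] x by simp
  qed
  moreover have "?B \<subseteq> free_gr b d"
    by (auto simp: free_gr_iff lookup_free_basis_vec split: if_splits)
  moreover have "card ?B = card ?T"
    by (intro card_image inj_on_subset[OF inj_free_basis_vec]) auto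
  ultimately show "free_vs.dim (free_gr b d :: ('n, 'm, 'k) cox_free set) = card ?T"
    using span by (intro free_vs.dim_unique[of ?B]) auto
  show "\<exists>B. finite B \<and> (free_gr b d :: ('n, 'm, 'k) cox_free set) \<subseteq> free_vs.span B"
    using span assms by blast
qed

text \<open>Twists and monomial degrees are nonnegative, which confines \<open>e\<close> to a box.
  The box is allowed to exceed \<open>(i, j)\<close>, where no monomials remain, so that one box
  serves all entries below \<open>(I, J)\<close>.\<close>

lemma free_basis_ind_Sigma:
  assumes "\<And>i j. b (i, j) \<noteq> 0 \<Longrightarrow> i \<ge> 0 \<and> j \<ge> 0" and "i \<le> I" "j \<le> J"
  shows "free_basis_ind b (i, j) =
     (SIGMA e:{0..I} \<times> {0..J}. {..<b e} \<times> mons UNIV ((i, j) - e))"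
proof -
  have "e \<in> {0..I} \<times> {0..J}" if "l < b e" "e + mon_bideg t = (i, j)"
    for e l and t :: "'a + 'b \<Rightarrow>\<^sub>0 nat"
  proof -
    have "fst e \<ge> 0" "snd e \<ge> 0"
      using that(1) assms(1)[of "fst e" "snd e"] by auto
    moreover have "fst e + fst (mon_bideg t) = i" "snd e + snd (mon_bideg t) = j"
      using arg_cong[OF that(2), of fst] arg_cong[OF that(2), of snd] by simp_all
    ultimately show ?thesis
      using assms(2,3) mon_bideg_nonneg[of t] by (simp add: mem_Times_iff)
  qed
  moreover have "e + mon_bideg t = (i, j) \<longleftrightarrow> mon_bideg t = (i, j) - e"
    for e and t :: "'a + 'b \<Rightarrow>\<^sub>0 nat"
    by (metis add_diff_cancel_left' add_diff_eq)
  ultimately show ?thesis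
    unfolding free_basis_ind_def mons_def by blast
qed

lemma finite_free_basis_ind:
  assumes "\<And>i j. b (i, j) \<noteq> 0 \<Longrightarrow> i \<ge> 0 \<and> j \<ge> 0"
  shows "finite (free_basis_ind b d)"
proof -
  obtain i j where d: "d = (i, j)" by (cases d)
  show ?thesis
    unfolding d by (subst free_basis_ind_Sigma[OF assms order_refl order_refl]) (auto simp: finite_mons)
qed

lemma dim_free_gr_eq_sum:
  assumes "\<And>i j. b (i, j) \<noteq> 0 \<Longrightarrow> i \<ge> 0 \<and> j \<ge> 0" and "i \<le> I" "j \<le> J"
  shows "int (free_vs.dim (free_gr b (i, j) :: ('n::finite, 'm::finite, 'k::field) cox_free set)) =
     (\<Sum>e\<in>{0..I} \<times> {0..J}. int (b e) * mon_count (UNIV :: ('n + 'm) set) (i - fst e) (j - snd e))"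
proof -
  have "card (free_basis_ind b (i, j) :: (_ \<times> _ \<times> (('n + 'm) \<Rightarrow>\<^sub>0 nat)) set) =
      (\<Sum>e\<in>{0..I} \<times> {0..J}. b e * card (mons UNIV ((i, j) - e) :: (('n + 'm) \<Rightarrow>\<^sub>0 nat) set))"
    by (subst free_basis_ind_Sigma[OF assms])
      (auto simp: finite_mons card_cartesian_product intro: sum.cong)
  then show ?thesis
    by (simp add: dim_free_gr(1)[OF finite_free_basis_ind[OF assms(1)]] mon_count_def minus_prod_def)
qed

section \<open>Homogeneous components\<close>

text \<open>The projection to degree \<open>d\<close> works on the ambient type for all
  \<open>b\<close> at once, as the basis vector at \<open>(e, l)\<close> has degree \<open>e\<close>
  in each free module containing it.\<close>

definition free_comp ::
  "int \<times> int \<Rightarrow> ('n::finite, 'm::finite, 'k::field) cox_free \<Rightarrow> ('n, 'm, 'k) cox_free" where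
  "free_comp d = Poly_Mapping.mapp (\<lambda>x. Poly_Mapping.mapp (\<lambda>t c. c when fst x + mon_bideg t = d))"

lemma lookup_free_comp:
  "Poly_Mapping.lookup (Poly_Mapping.lookup (free_comp d f) (e, l)) t =
     (Poly_Mapping.lookup (Poly_Mapping.lookup f (e, l)) t when e + mon_bideg t = d)"
  by (cases "(e, l) \<in> Poly_Mapping.keys f")
    (auto simp: free_comp_def mapp.rep_eq when_def in_keys_iff)

lemma free_comp_in_free_gr: "f \<in> free_mod b \<Longrightarrow> free_comp d f \<in> free_gr b d"
  by (auto simp: free_gr_iff free_mod_iff free_basis_ind_def lookup_free_comp)

lemma free_comp_of_free_gr:
  assumes "f \<in> free_gr b d'"
  shows "free_comp d f = (if d = d' then f else 0)"
proof (intro poly_mapping_eqI)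
  fix x :: "(int \<times> int) \<times> nat" and t
  obtain e l where x: "x = (e, l)" by (cases x)
  show "Poly_Mapping.lookup (Poly_Mapping.lookup (free_comp d f) x) t =
      Poly_Mapping.lookup (Poly_Mapping.lookup (if d = d' then f else 0) x) t"
    using assms[unfolded free_gr_iff, rule_format, of e l t] unfolding free_basis_ind_def x
    by (auto simp: lookup_free_comp when_def)
qed

lemma free_comp_sum: "free_comp d (sum f D) = (\<Sum>x\<in>D. free_comp d (f x))"
proof (intro poly_mapping_eqI)
  fix x :: "(int \<times> int) \<times> nat" and t
  obtain e l where x: "x = (e, l)" by (cases x)
  show "Poly_Mapping.lookup (Poly_Mapping.lookup (free_comp d (sum f D)) x) t =
      Poly_Mapping.lookup (Poly_Mapping.lookup (\<Sum>x\<in>D. free_comp d (f x)) x) t"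
    by (simp add: x lookup_free_comp lookup_sum when_def)
qed

lemma free_comp_decomposition: "\<exists>D. finite D \<and> f = (\<Sum>d\<in>D. free_comp d f)"
proof -
  \<comment> \<open>These are the degrees of the finitely many terms of \<open>f\<close>.\<close>
  define D where "D = (\<Union>x\<in>Poly_Mapping.keys f.
      (\<lambda>t. fst x + mon_bideg t) ` Poly_Mapping.keys (Poly_Mapping.lookup f x))"
  have fin: "finite D" by (simp add: D_def)
  have "f = (\<Sum>d\<in>D. free_comp d f)"
  proof (intro poly_mapping_eqI)
    fix x :: "(int \<times> int) \<times> nat" and t
    obtain e l where x: "x = (e, l)" by (cases x)
    have "Poly_Mapping.lookup (Poly_Mapping.lookup f (e, l)) t = 0" if "e + mon_bideg t \<notin> D"
    proof (rule ccontr)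
      assume "Poly_Mapping.lookup (Poly_Mapping.lookup f (e, l)) t \<noteq> 0"
      then have "t \<in> Poly_Mapping.keys (Poly_Mapping.lookup f (e, l))" "(e, l) \<in> Poly_Mapping.keys f"
        by (auto simp: in_keys_iff)
      then have "e + mon_bideg t \<in> D" by (force simp: D_def)
      then show False using that by simp
    qed
    then show "Poly_Mapping.lookup (Poly_Mapping.lookup f x) t =
        Poly_Mapping.lookup (Poly_Mapping.lookup (\<Sum>d\<in>D. free_comp d f) x) t"
      using fin by (simp add: x lookup_sum lookup_free_comp when_def)
  qed
  with fin show ?thesis by blast
qed

text \<open>This is the uniqueness half of a direct sum decomposition, isolated so that the module
  and the free modules can be treated alike.\<close>

definition graded_independent :: "('d \<Rightarrow> 'c::ab_group_add set) \<Rightarrow> bool" where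
  "graded_independent gr \<longleftrightarrow> (\<forall>D y d. finite D \<longrightarrow> (\<forall>e\<in>D. y e \<in> gr e) \<longrightarrow> sum y D \<in> gr d \<longrightarrow>
     sum y D = (if d \<in> D then y d else 0))"

lemma graded_independent_free_gr: "graded_independent (free_gr b)"
  unfolding graded_independent_def
proof (intro allI impI)
  fix D y d
  assume "finite D" and y: "\<forall>e\<in>D. y e \<in> free_gr b e" and s: "sum y D \<in> free_gr b d"
  have "sum y D = free_comp d (sum y D)"
    using free_comp_of_free_gr[OF s, of d] by simp
  also have "\<dots> = (\<Sum>e\<in>D. if d = e then y e else 0)"
    unfolding free_comp_sum using y by (intro sum.cong) (auto simp: free_comp_of_free_gr)
  also have "\<dots> = (if d \<in> D then y d else 0)"
    using \<open>finite D\<close> by simp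
  finally show "sum y D = (if d \<in> D then y d else 0)" .
qed

lemma (in bigraded_module) graded_independent_gr: "graded_independent gr"
  unfolding graded_independent_def
proof (intro allI impI)
  fix D y d
  assume D: "finite D" and y: "\<forall>e\<in>D. y e \<in> gr e" and s: "sum y D \<in> gr d"
  let ?P = "\<lambda>f. (\<forall>d. f d \<in> gr d) \<and> finite {d. f d \<noteq> 0} \<and> sum y D = (\<Sum>d | f d \<noteq> 0. f d)"
  \<comment> \<open>Two decompositions of the same element: the given one extended by zero, and the
    one concentrated in degree \<open>d\<close>. Uniqueness identifies them.\<close>
  let ?y = "\<lambda>e. if e \<in> D then y e else 0"
  let ?s = "\<lambda>e. if e = d then sum y D else 0"
  have "finite {e. ?y e \<noteq> 0}" by (rule finite_subset[OF _ D]) auto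
  moreover have "(\<Sum>e | ?y e \<noteq> 0. ?y e) = sum y D"
    using D by (intro sum.mono_neutral_cong_left) auto
  ultimately have "?P ?y" using y gr_zero by auto
  moreover have "?P ?s"
  proof -
    have "{e. ?s e \<noteq> 0} = (if sum y D = 0 then {} else {d})" by auto
    then show ?thesis using s gr_zero by auto
  qed
  moreover have "\<exists>!f. ?P f" by (rule gr_direct_sum)
  ultimately have "The ?P = ?y" "The ?P = ?s"
    by (iprover intro: the1_equality)+
  then have "?y = ?s" by (rule HOL.trans[OF sym])
  from fun_cong[OF this, of d] show "sum y D = (if d \<in> D then y d else 0)" by simp
qed

section \<open>Graded homomorphisms out of free modules\<close>

lemma graded_hom_on_0:
  fixes f :: "('n, 'm, 'k::field) cox_free \<Rightarrow> 'c::ab_group_add"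
  assumes "graded_hom_on free_scale (free_mod b) gA sB gB f"
  shows "f 0 = 0"
proof -
  have "0 \<in> (free_mod b :: ('n, 'm, 'k) cox_free set)" by (simp add: free_mod_def)
  then have "f (0 + 0) = f 0 + f 0" using assms unfolding graded_hom_on_def by blast
  then show ?thesis by simp
qed

lemma subspace_free_mod: "free_vs.subspace (free_mod b)"
  by (rule free_vs.subspaceI)
    (auto simp: free_mod_iff lookup_add lookup_free_scale_const, metis add.right_neutral)

lemma graded_hom_on_sum:
  fixes f :: "('n, 'm, 'k::field) cox_free \<Rightarrow> 'c::ab_group_add"
  assumes "graded_hom_on free_scale (free_mod b) gA sB gB f"
    and "\<And>x. x \<in> D \<Longrightarrow> g x \<in> free_mod b"
  shows "f (sum g D) = (\<Sum>x\<in>D. f (g x))"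
  using assms(2)
proof (induction D rule: infinite_finite_induct)
  case (insert x D)
  then show ?case
    using assms(1) free_vs.subspace_sum[OF subspace_free_mod, of D g b] by (simp add: graded_hom_on_def)
qed (simp_all add: graded_hom_on_0[OF assms(1)])

lemma graded_hom_on_in_gr: "graded_hom_on sA A gA sB gB f \<Longrightarrow> x \<in> gA d \<Longrightarrow> f x \<in> gB d"
  unfolding graded_hom_on_def by blast

lemma free_gr_subset_free_mod: "free_gr b d \<subseteq> free_mod b"
  by (auto simp: free_gr_def)

text \<open>This passes exactness from whole modules to a single bidegree. If the image of
  \<open>x\<close> is homogeneous of degree \<open>d\<close>, the images of the other components of
  \<open>x\<close> contribute nothing, so the component of degree \<open>d\<close> is already a
  preimage.\<close>

lemma graded_hom_on_image_gr:
  fixes f :: "('n::finite, 'm::finite, 'k::field) cox_free \<Rightarrow> 'c::ab_group_add"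
  assumes f: "graded_hom_on free_scale (free_mod b) (free_gr b) sB gB f"
    and gB: "graded_independent gB"
  shows "f ` free_gr b d = f ` free_mod b \<inter> gB d"
proof
  show "f ` free_gr b d \<subseteq> f ` free_mod b \<inter> gB d"
    using f free_gr_subset_free_mod[of b d] graded_hom_on_in_gr[OF f] by blast
  show "f ` free_mod b \<inter> gB d \<subseteq> f ` free_gr b d"
  proof
    fix y assume "y \<in> f ` free_mod b \<inter> gB d"
    then obtain x where x: "x \<in> free_mod b" "y = f x" "f x \<in> gB d" by auto
    obtain D where D: "finite D" "x = (\<Sum>e\<in>D. free_comp e x)"
      using free_comp_decomposition by blast
    have xe: "free_comp e x \<in> free_gr b e" for e using x(1) by (rule free_comp_in_free_gr)
    then have "f (\<Sum>e\<in>D. free_comp e x) = (\<Sum>e\<in>D. f (free_comp e x))"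
      using free_gr_subset_free_mod by (intro graded_hom_on_sum[OF f]) blast
    then have s: "f x = (\<Sum>e\<in>D. f (free_comp e x))" using D(2) by simp
    have "f (free_comp e x) \<in> gB e" for e
      using f xe by (rule graded_hom_on_in_gr)
    then have "f x = (if d \<in> D then f (free_comp d x) else 0)"
      using gB[unfolded graded_independent_def, rule_format, of D "\<lambda>e. f (free_comp e x)" d] D(1) x(3) s
      by metis
    moreover have "0 \<in> f ` free_gr b d"
      using graded_hom_on_0[OF f] free_vs.subspace_0[OF subspace_free_gr] by (metis image_eqI)
    ultimately show "y \<in> f ` free_gr b d" using xe[of d] x(2) by (auto split: if_splits)
  qed
qed

section \<open>Rank-nullity\<close>

text \<open>Rank-nullity for a map that is linear on the subspace \<open>V\<close> only, as the maps
  of a resolution are constrained only on their source carriers. A basis of the kernel is extended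
  to a basis of \<open>V\<close>, and the added vectors map to a basis of the image.\<close>

lemma (in vector_space_pair) dim_kernel_image_on:
  assumes V: "vs1.subspace V" and fin: "finite S" "V \<subseteq> vs1.span S"
    and add: "\<And>x y. x \<in> V \<Longrightarrow> y \<in> V \<Longrightarrow> f (x + y) = f x + f y"
    and scale: "\<And>c x. x \<in> V \<Longrightarrow> f (s1 c x) = s2 c (f x)"
  shows "vs1.dim V = vs1.dim {x \<in> V. f x = 0} + vs2.dim (f ` V)"
proof -
  let ?K = "{x \<in> V. f x = 0}"
  obtain K where K: "K \<subseteq> ?K" "vs1.independent K" "?K \<subseteq> vs1.span K"
    by (rule vs1.maximal_independent_subset)
  have "K \<subseteq> V" using K(1) by auto
  from vs1.maximal_independent_subset_extend[OF this K(2)]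
  obtain B where B: "K \<subseteq> B" "B \<subseteq> V" "vs1.independent B" "V \<subseteq> vs1.span B" .
  have finB: "finite B"
    using vs1.independent_span_bound[OF fin(1) B(3)] B(2) fin(2) by blast
  have spanB: "vs1.span B = V" using B V vs1.span_subspace by blast
  \<comment> \<open>A globally linear map that agrees with \<open>f\<close> on the basis
    \<open>B\<close>, hence on \<open>V\<close>.\<close>
  define g where "g = construct B f"
  have g: "Vector_Spaces.linear s1 s2 g" unfolding g_def by (rule linear_construct[OF B(3)])
  then interpret g: Vector_Spaces.linear s1 s2 g .
  have f0: "f 0 = 0"
    using add[of 0 0] vs1.subspace_0[OF V] by simp
  have eq: "f x = g x" if "x \<in> V" for x
  proof -
    have "vs1.subspace {x \<in> V. f x = g x}"
      by (rule vs1.subspaceI)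
        (auto simp: f0 g.zero g.add g.scale add scale V vs1.subspace_0 vs1.subspace_add vs1.subspace_scale)
    moreover have "B \<subseteq> {x \<in> V. f x = g x}"
      using B by (auto simp: g_def construct_basis)
    ultimately show ?thesis
      using vs1.span_minimal[of B "{x \<in> V. f x = g x}"] that spanB by blast
  qed
  have sub: "vs1.span (B - K) \<subseteq> V"
    using vs1.span_mono[of "B - K" B] spanB by auto
  \<comment> \<open>Such an \<open>x\<close> lies in the kernel and hence in the span of
    \<open>K\<close>. Its expansion in \<open>B\<close> is supported both in \<open>K\<close> and
    outside \<open>K\<close>, so it is empty.\<close>
  have "x = 0" if x: "x \<in> vs1.span (B - K)" "g x = 0" for x
  proof -
    have "x \<in> vs1.span K" using x sub eq K(3) by fastforce
    then have "vs1.representation (B - K) x = vs1.representation K x"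
      using vs1.representation_extend[OF B(3), of x] x(1) B(1) by (metis Diff_subset)
    then have "vs1.representation (B - K) x b = 0" for b
      using vs1.representation_ne_zero[of "B - K" x b] vs1.representation_ne_zero[of K x b] by auto
    then show ?thesis
      using vs1.sum_nonzero_representation_eq[OF vs1.independent_mono[OF B(3)] x(1)] by simp
  qed
  then have inj: "inj_on g (vs1.span (B - K))"
    by (simp add: g.inj_on_iff_eq_0)
  have "vs2.dim (f ` V) = card (g ` (B - K))"
  proof (rule vs2.dim_unique)
    show "g ` (B - K) \<subseteq> f ` V" using B eq by fastforce
    have "g b \<in> vs2.span (g ` (B - K))" if "b \<in> B" for b
    proof (cases "b \<in> K")
      case True
      then have "g b = 0" using K(1) eq by auto
      then show ?thesis by (simp add: vs2.span_zero)
    next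
      case False
      then show ?thesis using that by (intro vs2.span_base) auto
    qed
    then have "vs2.span (g ` B) \<subseteq> vs2.span (g ` (B - K))"
      by (intro vs2.span_minimal) auto
    moreover have "f ` V \<subseteq> vs2.span (g ` B)"
      using eq spanB by (auto simp: g.span_image)
    ultimately show "f ` V \<subseteq> vs2.span (g ` (B - K))" by blast
    show "vs2.independent (g ` (B - K))"
      using vs1.independent_mono[OF B(3)] inj by (intro linear_independent_injective_image[OF g]) auto
  qed simp
  also have "\<dots> = card (B - K)"
    using inj by (intro card_image inj_on_subset[OF inj] vs1.span_superset)
  finally have "vs2.dim (f ` V) = card (B - K)" .
  moreover have "vs1.dim ?K = card K" using K vs1.basis_card_eq_dim by metis
  moreover have "vs1.dim V = card B" using B vs1.basis_card_eq_dim by metis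
  moreover have "card B = card K + card (B - K)"
    using B(1) finB by (metis card_Diff_subset card_mono le_add_diff_inverse finite_subset)
  ultimately show ?thesis by simp
qed

section \<open>Minimality\<close>

text \<open>Polynomials without constant term form an ideal that contains the variables.\<close>

lemma lookup_0_cox_max_ideal:
  fixes p :: "('n::finite, 'm::finite, 'k::field) cox"
  assumes "p \<in> cox_max_ideal"
  shows "Poly_Mapping.lookup p 0 = 0"
proof -
  interpret m: module "(*) :: ('n, 'm, 'k) cox \<Rightarrow> _" 
    by unfold_locales (auto simp: algebra_simps)
  have "m.subspace {p. Poly_Mapping.lookup p 0 = 0}"
    by (rule m.subspaceI) (simp_all add: lookup_add lookup_times_0)
  moreover have "cox_var ` UNIV \<subseteq> {p :: ('n, 'm, 'k) cox. Poly_Mapping.lookup p 0 = 0}"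
    by (auto simp: cox_var_def lookup_single when_def poly_mapping_eq_iff fun_eq_iff)
  ultimately show ?thesis
    using m.span_minimal assms unfolding cox_max_ideal_def by blast
qed

lemma lookup_0_ideal_times_free:
  fixes f :: "('n::finite, 'm::finite, 'k::field) cox_free"
  assumes "f \<in> ideal_times_free cox_max_ideal N"
  shows "Poly_Mapping.lookup (Poly_Mapping.lookup f x) 0 = 0"
proof -
  interpret m: module "free_scale :: ('n, 'm, 'k) cox \<Rightarrow> _" by (rule module_free_scale)
  let ?V = "{f :: ('n, 'm, 'k) cox_free. \<forall>x. Poly_Mapping.lookup (Poly_Mapping.lookup f x) 0 = 0}"
  have "m.subspace ?V"
    by (rule m.subspaceI) (simp_all add: lookup_add lookup_times_0 lookup_free_scale)
  moreover have "{free_scale p f | p f. p \<in> cox_max_ideal \<and> f \<in> N} \<subseteq> ?V"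
    by (auto simp: lookup_free_scale lookup_times_0 lookup_0_cox_max_ideal)
  ultimately show ?thesis
    using m.span_minimal assms unfolding ideal_times_free_def by blast
qed

lemma minimal_free_resolutionD:
  assumes "minimal_free_resolution scale gr \<beta> \<epsilon> \<delta>"
  shows "\<beta> k (i, j) \<noteq> 0 \<Longrightarrow> i \<ge> 0 \<and> j \<ge> 0"
    and "graded_hom_on free_scale (free_mod (\<beta> 0)) (free_gr (\<beta> 0)) scale gr \<epsilon>"
    and "graded_hom_on free_scale (free_mod (\<beta> (Suc k))) (free_gr (\<beta> (Suc k)))
           free_scale (free_gr (\<beta> k)) (\<delta> k)"
    and "\<epsilon> ` free_mod (\<beta> 0) = UNIV"
    and "\<delta> 0 ` free_mod (\<beta> 1) = {f \<in> free_mod (\<beta> 0). \<epsilon> f = 0}"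
    and "\<delta> (Suc k) ` free_mod (\<beta> (Suc (Suc k))) = {f \<in> free_mod (\<beta> (Suc k)). \<delta> k f = 0}"
    and "\<delta> k ` free_mod (\<beta> (Suc k)) \<subseteq> ideal_times_free cox_max_ideal (free_mod (\<beta> k))"
proof -
  note def = assms[unfolded minimal_free_resolution_def]
  show "\<beta> k (i, j) \<noteq> 0 \<Longrightarrow> i \<ge> 0 \<and> j \<ge> 0"
    using conjunct1[OF def] by blast
qed (use assms in \<open>simp_all only: minimal_free_resolution_def\<close>)

text \<open>This is where minimality enters. It leaves only finitely many nonzero modules of the
  resolution in each bidegree.\<close>

lemma minimal_free_resolution_degree_ge:
  fixes scale :: "('n::finite, 'm::finite, 'k::field) cox \<Rightarrow> 'b::ab_group_add \<Rightarrow> 'b"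
  assumes res: "minimal_free_resolution scale gr \<beta> \<epsilon> \<delta>"
  shows "\<beta> k e \<noteq> 0 \<Longrightarrow> int k \<le> fst e + snd e"
proof (induction k arbitrary: e)
  case 0
  then show ?case
    using minimal_free_resolutionD(1)[OF res, of 0 "fst e" "snd e"] by simp
next
  case (Suc k)
  show ?case
  proof (rule ccontr)
    assume deg: "\<not> int (Suc k) \<le> fst e + snd e"
    \<comment> \<open>The first basis vector of degree \<open>e\<close>, which exists since the
      Betti number is nonzero.\<close>
    define b :: "('n, 'm, 'k) cox_free" where "b = free_basis_vec (e, 0, 0)"
    have b: "b \<in> free_gr (\<beta> (Suc k)) e"
      using Suc.prems by (auto simp: b_def free_gr_iff lookup_free_basis_vec free_basis_ind_def split: if_splits)
    have img: "\<delta> k b \<in> free_gr (\<beta> k) e"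
      using minimal_free_resolutionD(3)[OF res] b by (rule graded_hom_on_in_gr)
    have bmod: "b \<in> free_mod (\<beta> (Suc k))"
      using b free_gr_subset_free_mod by blast
    then have min: "\<delta> k b \<in> ideal_times_free cox_max_ideal (free_mod (\<beta> k))"
      using minimal_free_resolutionD(7)[OF res, of k] by blast
    \<comment> \<open>A nonzero coefficient has a twist \<open>e'\<close> of total degree at least
      \<open>k\<close>, while \<open>e\<close> has at most \<open>k\<close>. So
      \<open>t = 0\<close>, but elements of the ideal times the module have no constant
      coefficients.\<close>
    have "Poly_Mapping.lookup (Poly_Mapping.lookup (\<delta> k b) (e', l)) t = 0" for e' l t
    proof (rule ccontr)
      assume nz: "Poly_Mapping.lookup (Poly_Mapping.lookup (\<delta> k b) (e', l)) t \<noteq> 0"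
      then have "l < \<beta> k e'" and e: "e' + mon_bideg t = e"
        using img unfolding free_gr_iff free_basis_ind_def by blast+
      then have "int k \<le> fst e' + snd e'" by (intro Suc.IH) simp
      then have "fst (mon_bideg t) + snd (mon_bideg t) \<le> 0"
        using deg arg_cong[OF e, of fst] arg_cong[OF e, of snd] by simp
      then have "t = 0" by (rule mon_bideg_eq_0)
      then show False using nz lookup_0_ideal_times_free[OF min] by simp
    qed
    then have "\<delta> k b = 0"
      by (auto intro!: poly_mapping_eqI)
    \<comment> \<open>By exactness \<open>b\<close> is the image of an element of the next free
      module, and minimality applies to that differential.\<close>
    then have "b \<in> ideal_times_free cox_max_ideal (free_mod (\<beta> (Suc k)))"
      using minimal_free_resolutionD(6,7)[OF res] bmod by blast
    then show False
      using lookup_0_ideal_times_free[of b _ "(e, 0)"] by (simp add: b_def lookup_free_basis_vec)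
  qed
qed

section \<open>The Hilbert matrix as an alternating sum\<close>

lemma dim_free_gr_split:
  fixes s :: "('n::finite, 'm::finite, 'k::field) cox \<Rightarrow> 'b::ab_group_add \<Rightarrow> 'b"
  assumes s: "module s" and f: "graded_hom_on free_scale (free_mod b) (free_gr b) s gB f"
    and b: "\<And>i j. b (i, j) \<noteq> 0 \<Longrightarrow> i \<ge> 0 \<and> j \<ge> 0"
  shows "free_vs.dim (free_gr b d :: ('n, 'm, 'k) cox_free set) = free_vs.dim {x \<in> free_gr b d. f x = 0}
     + vector_space.dim (\<lambda>c. s (cox_const c)) (f ` free_gr b d)"
proof -
  interpret vs: vector_space "\<lambda>c. s (cox_const c)" using s by (rule vector_space_cox_const)
  interpret vector_space_pair "\<lambda>c. free_scale (cox_const c :: ('n, 'm, 'k) cox)" "\<lambda>c. s (cox_const c)"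
    by unfold_locales
  obtain B :: "('n, 'm, 'k) cox_free set" where "finite B" "free_gr b d \<subseteq> free_vs.span B"
    using dim_free_gr(2)[OF finite_free_basis_ind[OF b]] by blast
  then show ?thesis
  proof (rule dim_kernel_image_on[OF subspace_free_gr])
    have "free_gr b d \<subseteq> free_mod b" by (rule free_gr_subset_free_mod)
    then show "f (x + y) = f x + f y" "f (free_scale (cox_const c) x) = s (cox_const c) (f x)"
      if "x \<in> free_gr b d" "y \<in> free_gr b d" for x y c
      using f that unfolding graded_hom_on_def by blast+
  qed
qed

lemma hilbert_matrix_eq_alternating_sum:
  fixes scale :: "('n::finite, 'm::finite, 'k::field) cox \<Rightarrow> 'b::ab_group_add \<Rightarrow> 'b"
  assumes M: "bigraded_module scale gr"
    and res: "minimal_free_resolution scale gr \<beta> \<epsilon> \<delta>"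
    and K: "i + j < int K"
  shows "hilbert_matrix scale gr i j =
    (\<Sum>k<K. (- 1) ^ k * int (free_vs.dim (free_gr (\<beta> k) (i, j) :: ('n, 'm, 'k) cox_free set)))"
proof -
  interpret bigraded_module scale gr by fact
  let ?V = "\<lambda>k. free_gr (\<beta> k) (i, j) :: ('n, 'm, 'k) cox_free set"
  \<comment> \<open>The cycles in bidegree \<open>(i, j)\<close>, with the augmentation as the
    outgoing map at \<open>k = 0\<close>.\<close>
  let ?Z = "\<lambda>k. if k = 0 then {x \<in> ?V 0. \<epsilon> x = 0} else {x \<in> ?V k. \<delta> (k - 1) x = 0}"
  note nonneg = minimal_free_resolutionD(1)[OF res]
    and \<epsilon> = minimal_free_resolutionD(2)[OF res] and \<delta> = minimal_free_resolutionD(3)[OF res]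
    and exact = minimal_free_resolutionD(4-6)[OF res]
  have "\<epsilon> ` ?V 0 = gr (i, j)"
    using graded_hom_on_image_gr[OF \<epsilon> graded_independent_gr, of "(i, j)"] exact(1) by simp
  then have H: "int (free_vs.dim (?V 0)) = int (free_vs.dim (?Z 0)) + hilbert_matrix scale gr i j"
    using dim_free_gr_split[OF module_axioms \<epsilon> nonneg[where k = 0], where d = "(i, j)"]
    by (simp add: hilbert_matrix_def)
  have "\<delta> k ` ?V (Suc k) = ?Z k" for k
    using graded_hom_on_image_gr[OF \<delta>[of k] graded_independent_free_gr, where d = "(i, j)"] exact(2,3)
      subsetD[OF free_gr_subset_free_mod[of "\<beta> k" "(i, j)"]]
    by (cases k) auto
  then have Z: "int (free_vs.dim (?V (Suc k))) = int (free_vs.dim (?Z (Suc k))) + int (free_vs.dim (?Z k))" for k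
    using dim_free_gr_split[OF module_free_scale \<delta>[of k] nonneg[where k = "Suc k"], where d = "(i, j)"] by simp
  \<comment> \<open>Each dimension is that of the cycles at \<open>k\<close> plus that of the cycles
    at \<open>k - 1\<close>, or of the module at \<open>k = 0\<close>. The alternating sum
    telescopes up to the last cycles.\<close>
  have sum: "(\<Sum>k<Suc K. (- 1) ^ k * int (free_vs.dim (?V k))) =
     hilbert_matrix scale gr i j + (- 1) ^ K * int (free_vs.dim (?Z K))" for K
  proof (induction K)
    case 0
    show ?case using H by simp
  next
    case (Suc K)
    show ?case
      by (subst sum.lessThan_Suc, subst Suc.IH, subst Z) (simp add: algebra_simps)
  qed
  \<comment> \<open>Generators of the module at \<open>K\<close> have total degree at least
    \<open>K\<close>, which exceeds \<open>i + j\<close>. So both the last summand and the last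
    cycles vanish.\<close>
  have V0: "?V K = {0}"
  proof -
    have no_ind: "\<not> (l < \<beta> K e \<and> e + mon_bideg t = (i, j))" for e l and t :: "'n + 'm \<Rightarrow>\<^sub>0 nat"
    proof
      assume *: "l < \<beta> K e \<and> e + mon_bideg t = (i, j)"
      then have "int K \<le> fst e + snd e"
        using minimal_free_resolution_degree_ge[OF res] by auto
      moreover have "fst e + fst (mon_bideg t) = i" "snd e + snd (mon_bideg t) = j"
        using * by (metis fst_add fst_conv, metis snd_add snd_conv)
      ultimately show False
        using K mon_bideg_nonneg[of t] by linarith
    qed
    have "f = 0" if "f \<in> ?V K" for f
    proof (intro poly_mapping_eqI)
      fix x :: "(int \<times> int) \<times> nat" and t
      obtain e l where "x = (e, l)" by (cases x)
      then show "Poly_Mapping.lookup (Poly_Mapping.lookup f x) t =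
          Poly_Mapping.lookup (Poly_Mapping.lookup 0 x) t"
        using that no_ind[of l e t] by (auto simp only: free_gr_iff free_basis_ind_def
            lookup_zero mem_Collect_eq prod.case)
    qed
    then show ?thesis
      using free_vs.subspace_0[OF subspace_free_gr] by blast
  qed
  then have "?V K \<subseteq> {0}" "?Z K \<subseteq> {0}" by auto
  moreover have "free_vs.dim V = 0" if "V \<subseteq> {0}" for V :: "('n, 'm, 'k) cox_free set"
    using free_vs.dim_le_card[of V "{}"] that by simp
  ultimately have "free_vs.dim (?V K) = 0" "free_vs.dim (?Z K) = 0" by blast+
  then show ?thesis using sum[of K] by simp
qed

text \<open>Summability is part of the conclusion so that \<open>betti_alt_sum\<close> is a genuine
  sum and not a default value of \<open>suminf\<close>.\<close>

theorem proposition1p5: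
  fixes n m :: nat
    and scale :: "('n::finite, 'm::finite, 'k::alg_closed_field) cox \<Rightarrow> 'b::ab_group_add \<Rightarrow> 'b"
    and M :: "int \<times> int \<Rightarrow> 'b set"
    and \<beta> :: "nat \<Rightarrow> int \<times> int \<Rightarrow> nat"
    and \<epsilon> :: "('n, 'm, 'k) cox_free \<Rightarrow> 'b"
    and \<delta> :: "nat \<Rightarrow> ('n, 'm, 'k) cox_free \<Rightarrow> ('n, 'm, 'k) cox_free"
  assumes "CARD('n) = n + 1" and "CARD('m) = m + 1"
    and "bigraded_module scale M"
    and "fin_gen_module scale"
    and "minimal_free_resolution scale M \<beta> \<epsilon> \<delta>"
  shows "(\<forall>p q. summable (\<lambda>k. (- 1) ^ k * int (\<beta> k (p, q)))) \<and>
    (\<forall>i j. (diff_col ^^ (n + 1)) ((diff_row ^^ (m + 1)) (hilbert_matrix scale M)) i j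
       = betti_alt_sum \<beta> i j)"
proof (intro conjI allI)
  note deg = minimal_free_resolution_degree_ge[OF assms(5)]
  note nonneg = minimal_free_resolutionD(1)[OF assms(5)]
  have vanish: "(- 1) ^ k * int (\<beta> k (p, q)) = 0" if "k \<notin> {..<K}" "p + q < int K" for p q k K
    using deg[of k "(p, q)"] that by (cases "\<beta> k (p, q) = 0") auto
  show "summable (\<lambda>k. (- 1) ^ k * int (\<beta> k (p, q)))" for p q
    by (rule summable_finite[of "{..<nat (p + q + 1)}"]) (simp, rule vanish, auto)
  fix I J :: int
  \<comment> \<open>This \<open>K\<close> exceeds \<open>i + j\<close> for all entries below
    \<open>(I, J)\<close>. If \<open>I + J\<close> is negative, it is \<open>0\<close> and the sums
    over \<open>k\<close> are empty.\<close>
  define K where "K = nat (I + J + 1)"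
  define E where "E = {0..I} \<times> {0..J}"
  \<comment> \<open>The truncated alternating sum of Betti numbers. In the quadrant the Hilbert
    matrix is the convolution of \<open>c\<close> with the Hilbert function of the ring.\<close>
  define c where "c e = (\<Sum>k<K. (- 1) ^ k * int (\<beta> k e))" for e
  let ?N = "mon_count (UNIV :: ('n + 'm) set)"
  let ?G = "\<lambda>i j. \<Sum>e\<in>E. c e * ?N (i - fst e) (j - snd e)"
  have H: "hilbert_matrix scale M i j = ?G i j" if "i \<le> I" "j \<le> J" for i j
  proof -
    have "i + j < int K" using that by (simp add: K_def)
    moreover have dim: "int (free_vs.dim (free_gr (\<beta> k) (i, j) :: ('n, 'm, 'k) cox_free set)) =
        (\<Sum>e\<in>E. int (\<beta> k e) * ?N (i - fst e) (j - snd e))" for k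
      unfolding E_def by (rule dim_free_gr_eq_sum[OF nonneg that])
    ultimately have "hilbert_matrix scale M i j =
        (\<Sum>k<K. (- 1) ^ k * (\<Sum>e\<in>E. int (\<beta> k e) * ?N (i - fst e) (j - snd e)))"
      by (simp add: hilbert_matrix_eq_alternating_sum[OF assms(3,5)] dim)
    also have "\<dots> = ?G i j"
      unfolding c_def sum_distrib_left sum_distrib_right by (subst sum.swap) (simp add: mult.assoc)
    finally show ?thesis .
  qed
  have "(diff_col ^^ (n + 1)) ((diff_row ^^ (m + 1)) (hilbert_matrix scale M)) I J =
      (diff_col ^^ (n + 1)) ((diff_row ^^ (m + 1)) ?G) I J"
    by (intro diff_col_pow_local[of I J] diff_row_pow_local[of I J] H) auto
  also have "\<dots> = (\<Sum>e\<in>E. c e * (if I - fst e = 0 \<and> J - snd e = 0 then 1 else 0))"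
    unfolding diff_row_pow_sum diff_col_pow_sum
    using diff_mon_count_UNIV[where 'n = 'n and 'm = 'm] by (simp add: assms(1,2))
  also have "\<dots> = (\<Sum>e\<in>E. if e = (I, J) then c e else 0)"
    by (intro sum.cong) auto
  also have "\<dots> = c (I, J)"
  proof (cases "(I, J) \<in> E")
    \<comment> \<open>Outside the box a coordinate is negative, where all Betti numbers vanish, so
      both sides are \<open>0\<close>.\<close>
    case False
    then have "\<beta> k (I, J) = 0" for k
      using nonneg[of k I J] by (auto simp: E_def)
    then show ?thesis using False by (simp add: c_def E_def sum.delta)
  qed (simp add: E_def sum.delta)
  also have "\<dots> = betti_alt_sum \<beta> I J"
    unfolding betti_alt_sum_def c_def
    by (rule suminf_finite[symmetric]) (simp, rule vanish, auto simp: K_def)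
  finally show "(diff_col ^^ (n + 1)) ((diff_row ^^ (m + 1)) (hilbert_matrix scale M)) I J =
      betti_alt_sum \<beta> I J" .
qed

end
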